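(* Let $A,B\in\mathbb{R}^{m\times n}$ and $C,E\in\mathbb{R}^{p\times q}$, where $mq=np$. The following conditions are equivalent: (i) the system $AXC+B|X|E=F$ has a unique solution $X\in\mathbb{R}^{n\times p}$ for each $F\in\mathbb{R}^{m\times q}$; (ii) the system $|A^TXC^T|\leq|B^TXE^T|$, $X\in\mathbb{R}^{m\times q}$, has only the trivial solution $X=0$; (iii) the system $AXC+BYE=0$, $|Y|\leq|X|$, with $X,Y\in\mathbb{R}^{n\times p}$, has only the trivial solution $X=Y=0$.
   Context: Inequalities and absolute values of matrices are understood entrywise. *)

theory Defs
  imports "HOL-Analysis.Analysis"
begin

text \<open>
  The order and the absolute value on \<^typ>\<open>real ^ 'n ^ 'm\<close> are the library's componentwise
  instances for \<open>vec\<close>, applied twice, hence entrywise. The two lemmas make this explicit.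
\<close>

lemma matrix_le_iff_entrywise:
  fixes M N :: "real ^ 'n ^ 'm"
  shows "M \<le> N \<longleftrightarrow> (\<forall>i j. M $ i $ j \<le> N $ i $ j)"
  by (simp add: less_eq_vec_def)

lemma matrix_abs_nth:
  fixes M :: "real ^ 'n ^ 'm"
  shows "\<bar>M\<bar> $ i $ j = \<bar>M $ i $ j\<bar>"
  by (simp add: abs_vec_def)

end

theory Submission
  imports Defs
begin

text \<open>
  As \<open>m q = n p\<close>, reading a matrix as the vector of its entries turns the equation into a
  generalised absolute value equation \<open>G x + H \<bar>x\<bar> = f\<close> with square \<open>G\<close> and \<open>H\<close>, and the
  transposed maps \<open>X \<mapsto> A\<^sup>T X C\<^sup>T\<close> and \<open>X \<mapsto> B\<^sup>T X E\<^sup>T\<close> into \<open>G\<^sup>T\<close> and \<open>H\<^sup>T\<close>. The pivot between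
  the three conditions is \<^emph>\<open>regularity\<close>: \<open>G + H diag d\<close> is nonsingular for every \<open>d\<close> in the cube
  \<open>[-1,1]\<^sup>k\<close>. An inequality \<open>\<bar>y\<bar> \<le> \<bar>x\<bar>\<close> says exactly that \<open>y = diag d x\<close> for such a \<open>d\<close>
  (\<open>abs_le_iff_scaled_by_cube\<close>). So the homogeneous system in two unknowns describes the kernels of
  the matrices \<open>G + H diag d\<close>, and the inequality \<open>\<bar>G\<^sup>T x\<bar> \<le> \<bar>H\<^sup>T x\<bar>\<close> describes the kernels of
  their transposes; a square matrix and its transpose are singular together.

  The system in two unknowns is also exactly the obstruction to uniqueness. If \<open>x\<close> and \<open>y\<close> have the
  same image then \<open>G (x - y) + H (\<bar>x\<bar> - \<bar>y\<bar>) = 0\<close>, and by \<open>abs_le_iff_difference_of_abs\<close> the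
  pairs \<open>(x - y, \<bar>x\<bar> - \<bar>y\<bar>)\<close> are precisely the pairs \<open>(z, w)\<close> with \<open>\<bar>w\<bar> \<le> \<bar>z\<bar>\<close>. Existence
  comes for free: an injective continuous self-map of \<open>\<real>\<^sup>k\<close> has an open image by invariance of
  domain, which for a positively homogeneous map must be the whole space
  (\<open>bij_of_inj_continuous_pos_homogeneous\<close>).
\<close>

section \<open>Diagonal perturbations and their kernels\<close>

definition diag_perturbation :: "real ^ 'k ^ 'k \<Rightarrow> real ^ 'k ^ 'k \<Rightarrow> ('k \<Rightarrow> real) \<Rightarrow> real ^ 'k ^ 'k"
  where "diag_perturbation G H d = (\<chi> i j. G $ i $ j + H $ i $ j * d j)"

definition cube_regular :: "real ^ 'k ^ 'k \<Rightarrow> real ^ 'k ^ 'k \<Rightarrow> bool"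
  where "cube_regular G H \<longleftrightarrow>
    (\<forall>d. (\<forall>j. \<bar>d j\<bar> \<le> 1) \<longrightarrow> det (diag_perturbation G H d) \<noteq> 0)"

lemma diag_perturbation_mult:
  "diag_perturbation G H d *v x = G *v x + H *v (\<chi> j. d j * x $ j)"
  by (simp add: diag_perturbation_def vec_eq_iff matrix_vector_mult_def algebra_simps sum.distrib)

lemma transpose_diag_perturbation_mult:
  "transpose (diag_perturbation G H d) *v x
     = transpose G *v x + (\<chi> j. d j * (transpose H *v x) $ j)"
  by (simp add: diag_perturbation_def vec_eq_iff matrix_vector_mult_def transpose_def
      algebra_simps sum.distrib sum_distrib_left)

lemma det_nonzero_iff_trivial_kernel:
  fixes M :: "real ^ 'k ^ 'k"
  shows "det M \<noteq> 0 \<longleftrightarrow> (\<forall>x. M *v x = 0 \<longrightarrow> x = 0)"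
  by (simp add: invertible_det_nz [symmetric] invertible_left_inverse matrix_left_invertible_ker)

lemma abs_le_iff_scaled_by_cube:
  fixes x y :: "real ^ 'k"
  shows "\<bar>y\<bar> \<le> \<bar>x\<bar> \<longleftrightarrow> (\<exists>d. (\<forall>j. \<bar>d j\<bar> \<le> 1) \<and> y = (\<chi> j. d j * x $ j))"
proof
  assume le: "\<bar>y\<bar> \<le> \<bar>x\<bar>"
  then have le_nth: "\<bar>y $ j\<bar> \<le> \<bar>x $ j\<bar>" for j
    by (simp add: less_eq_vec_def abs_vec_def)
  \<comment> \<open>Where \<open>x\<close> vanishes so does \<open>y\<close>, and division by zero gives the admissible factor \<open>0\<close>.\<close>
  have "\<bar>y $ j / x $ j\<bar> \<le> 1" for j
    using le_nth[of j] by (cases "x $ j = 0") (auto simp: divide_le_eq)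
  moreover have "y = (\<chi> j. y $ j / x $ j * x $ j)"
    using le_nth by (auto simp: vec_eq_iff) (metis abs_le_zero_iff abs_zero)
  ultimately show "\<exists>d. (\<forall>j. \<bar>d j\<bar> \<le> 1) \<and> y = (\<chi> j. d j * x $ j)"
    by (intro exI[of _ "\<lambda>j. y $ j / x $ j"]) auto
next
  assume "\<exists>d. (\<forall>j. \<bar>d j\<bar> \<le> 1) \<and> y = (\<chi> j. d j * x $ j)"
  then show "\<bar>y\<bar> \<le> \<bar>x\<bar>"
    by (auto simp: less_eq_vec_def abs_vec_def abs_mult intro!: mult_left_le_one_le)
qed

lemma cube_regular_iff_dominated_system:
  "cube_regular G H \<longleftrightarrow> (\<forall>x y. G *v x + H *v y = 0 \<and> \<bar>y\<bar> \<le> \<bar>x\<bar> \<longrightarrow> x = 0)"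
  unfolding cube_regular_def det_nonzero_iff_trivial_kernel diag_perturbation_mult
    abs_le_iff_scaled_by_cube
  by blast

text \<open>
  A determinant is that of the transpose, and the transpose of \<open>G + H diag d\<close> kills \<open>x\<close> exactly if
  \<open>G\<^sup>T x\<close> equals \<open>H\<^sup>T x\<close> scaled by \<open>- d\<close>; the cube is symmetric under \<open>d \<mapsto> - d\<close>.
\<close>

lemma cube_regular_iff_transposed_inequality:
  "cube_regular G H \<longleftrightarrow> (\<forall>x. \<bar>transpose G *v x\<bar> \<le> \<bar>transpose H *v x\<bar> \<longrightarrow> x = 0)"
proof -
  have "(\<bar>transpose G *v x\<bar> \<le> \<bar>transpose H *v x\<bar>) \<longleftrightarrow>
      (\<exists>d. (\<forall>j. \<bar>d j\<bar> \<le> 1) \<and> transpose (diag_perturbation G H d) *v x = 0)" for x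
  proof -
    have "(\<bar>transpose G *v x\<bar> \<le> \<bar>transpose H *v x\<bar>) \<longleftrightarrow>
        (\<bar>- (transpose G *v x)\<bar> \<le> \<bar>transpose H *v x\<bar>)"
      by (simp add: less_eq_vec_def abs_vec_def)
    also have "\<dots> \<longleftrightarrow> (\<exists>d. (\<forall>j. \<bar>d j\<bar> \<le> 1) \<and>
        - (transpose G *v x) = (\<chi> j. d j * (transpose H *v x) $ j))"
      by (rule abs_le_iff_scaled_by_cube)
    also have "\<dots> \<longleftrightarrow> (\<exists>d. (\<forall>j. \<bar>d j\<bar> \<le> 1) \<and> transpose (diag_perturbation G H d) *v x = 0)"
      unfolding transpose_diag_perturbation_mult neg_eq_iff_add_eq_0 ..
    finally show ?thesis .
  qed
  moreover have "cube_regular G H \<longleftrightarrow> (\<forall>d. (\<forall>j. \<bar>d j\<bar> \<le> 1) \<longrightarrow>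
      (\<forall>x. transpose (diag_perturbation G H d) *v x = 0 \<longrightarrow> x = 0))"
    unfolding cube_regular_def det_nonzero_iff_trivial_kernel[symmetric] by (simp add: det_transpose)
  ultimately show ?thesis
    by blast
qed

section \<open>The absolute value map\<close>

text \<open>
  The image is open by invariance of domain and contains \<open>f 0 = 0\<close>. It thus contains a ball around
  the origin, and every vector is a nonnegative multiple of a vector in that ball.
\<close>

lemma bij_of_inj_continuous_pos_homogeneous:
  fixes f :: "'a::euclidean_space \<Rightarrow> 'a"
  assumes cont: "continuous_on UNIV f" and inj: "inj f"
    and hom: "\<And>t x. t \<ge> 0 \<Longrightarrow> f (t *\<^sub>R x) = t *\<^sub>R f x"
  shows "bij f"
proof -
  have "open (range f)"
    using invariance_of_domain[OF cont open_UNIV inj] .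
  moreover have "0 \<in> range f"
    using hom[of 0 0] by (metis order_refl rangeI scaleR_zero_left)
  ultimately obtain e where e: "e > 0" "ball 0 e \<subseteq> range f"
    unfolding open_contains_ball by blast
  have "b \<in> range f" for b
  proof (cases "b = 0")
    case True
    then show ?thesis using \<open>0 \<in> range f\<close> by simp
  next
    case False
    define t where "t = e / (2 * norm b)"
    have t: "t > 0" using e False by (simp add: t_def)
    have "t *\<^sub>R b \<in> ball 0 e"
      using e False by (simp add: t_def)
    then obtain x where x: "f x = t *\<^sub>R b"
      using e by (metis imageE subsetD)
    have "f ((1 / t) *\<^sub>R x) = b"
      using t by (simp add: hom x)
    then show ?thesis by (metis rangeI)
  qed
  then show ?thesis
    using inj by (auto simp: bij_def)
qed

definition abs_value_map :: "real ^ 'k ^ 'k \<Rightarrow> real ^ 'k ^ 'k \<Rightarrow> real ^ 'k \<Rightarrow> real ^ 'k"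
  where "abs_value_map G H x = G *v x + H *v \<bar>x\<bar>"

text \<open>
  One direction is the reverse triangle inequality. For the other, each coordinate of \<open>x - y = z\<close>
  and \<open>\<bar>x\<bar> - \<bar>y\<bar> = w\<close> is solved separately, with \<open>x\<close> and \<open>y\<close> on opposite sides of zero:
  \<open>x\<close> then has the sign of \<open>z\<close>, so \<open>\<bar>x\<bar> - \<bar>y\<bar>\<close> is \<open>x + y\<close> if \<open>z \<ge> 0\<close> and \<open>- (x + y)\<close> otherwise,
  and what remains is a linear system for \<open>x\<close> and \<open>y\<close>. The bound \<open>\<bar>w\<bar> \<le> \<bar>z\<bar>\<close> ensures that its
  solution has these signs.
\<close>

lemma abs_le_iff_difference_of_abs:
  fixes z w :: "real ^ 'k"
  shows "\<bar>w\<bar> \<le> \<bar>z\<bar> \<longleftrightarrow> (\<exists>x y. z = x - y \<and> w = \<bar>x\<bar> - \<bar>y\<bar>)"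
proof
  assume le: "\<bar>w\<bar> \<le> \<bar>z\<bar>"
  define x :: "real ^ 'k" where
    "x = (\<chi> k. if z $ k \<ge> 0 then (z $ k + w $ k) / 2 else (z $ k - w $ k) / 2)"
  have "w $ k = \<bar>x $ k\<bar> - \<bar>(x - z) $ k\<bar>" for k
  proof -
    have "\<bar>w $ k\<bar> \<le> \<bar>z $ k\<bar>"
      using le by (simp add: less_eq_vec_def abs_vec_def)
    then show ?thesis
      by (auto simp: x_def abs_if field_simps split: if_splits)
  qed
  then have "w = \<bar>x\<bar> - \<bar>x - z\<bar>"
    by (simp add: vec_eq_iff abs_vec_def)
  then show "\<exists>x y. z = x - y \<and> w = \<bar>x\<bar> - \<bar>y\<bar>"
    by (intro exI[of _ x] exI[of _ "x - z"]) simp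
next
  assume "\<exists>x y. z = x - y \<and> w = \<bar>x\<bar> - \<bar>y\<bar>"
  then show "\<bar>w\<bar> \<le> \<bar>z\<bar>"
    by (auto simp: less_eq_vec_def abs_vec_def abs_triangle_ineq3)
qed

text \<open>
  Two points have the same image exactly if \<open>z = x - y\<close> and \<open>w = \<bar>x\<bar> - \<bar>y\<bar>\<close> satisfy
  \<open>G z + H w = 0\<close>, and these pairs \<open>(z, w)\<close> are all the pairs with \<open>\<bar>w\<bar> \<le> \<bar>z\<bar>\<close>.
\<close>

lemma inj_abs_value_map_iff_dominated_system:
  "inj (abs_value_map G H) \<longleftrightarrow> (\<forall>z w. G *v z + H *v w = 0 \<and> \<bar>w\<bar> \<le> \<bar>z\<bar> \<longrightarrow> z = 0)"
proof -
  have "abs_value_map G H x = abs_value_map G H y \<longleftrightarrow> G *v (x - y) + H *v (\<bar>x\<bar> - \<bar>y\<bar>) = 0" for x y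
  proof -
    have "G *v (x - y) + H *v (\<bar>x\<bar> - \<bar>y\<bar>) = abs_value_map G H x - abs_value_map G H y"
      by (simp add: abs_value_map_def matrix_vector_mult_diff_distrib)
    then show ?thesis by simp
  qed
  then have "inj (abs_value_map G H) \<longleftrightarrow>
      (\<forall>x y. G *v (x - y) + H *v (\<bar>x\<bar> - \<bar>y\<bar>) = 0 \<longrightarrow> x - y = 0)"
    by (simp add: inj_def)
  also have "\<dots> \<longleftrightarrow> (\<forall>z w. G *v z + H *v w = 0 \<and> \<bar>w\<bar> \<le> \<bar>z\<bar> \<longrightarrow> z = 0)"
    unfolding abs_le_iff_difference_of_abs by blast
  finally show ?thesis .
qed

lemma bij_abs_value_map_iff_inj: "bij (abs_value_map G H) \<longleftrightarrow> inj (abs_value_map G H)"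
proof
  assume inj: "inj (abs_value_map G H)"
  show "bij (abs_value_map G H)"
  proof (rule bij_of_inj_continuous_pos_homogeneous[OF _ inj])
    show "continuous_on UNIV (abs_value_map G H)"
      unfolding abs_value_map_def abs_vec_def
      by (intro continuous_intros linear_continuous_on_compose[OF _ matrix_vector_mul_linear])
    show "abs_value_map G H (t *\<^sub>R x) = t *\<^sub>R abs_value_map G H x" if "t \<ge> 0" for t x
    proof -
      have "\<bar>t *\<^sub>R x\<bar> = t *\<^sub>R \<bar>x\<bar>"
        using that by (simp add: vec_eq_iff abs_vec_def abs_mult)
      then show ?thesis
        by (simp add: abs_value_map_def matrix_vector_mult_scaleR scaleR_right_distrib)
    qed
  qed
qed (rule bij_is_inj)

lemma bij_abs_value_map_iff_cube_regular:
  "bij (abs_value_map G H) \<longleftrightarrow> cube_regular G H"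
  by (simp only: bij_abs_value_map_iff_inj inj_abs_value_map_iff_dominated_system
      cube_regular_iff_dominated_system)

section \<open>Vectorisation\<close>

text \<open>
  The map \<open>X \<mapsto> A X C\<close> takes \<open>n \<times> p\<close> entries to \<open>m \<times> q\<close> entries. Listing both along the same index
  type, with \<open>id\<close> as the enumeration on one side and a bijection \<open>\<sigma>\<close> on the other, makes its matrix
  square, so that it has a determinant.
\<close>

definition flatten :: "('k \<Rightarrow> 'n \<times> 'p) \<Rightarrow> real ^ 'p ^ 'n \<Rightarrow> real ^ 'k"
  where "flatten \<sigma> X = (\<chi> r. X $ fst (\<sigma> r) $ snd (\<sigma> r))"

text \<open>Up to the enumeration of its rows, this is the Kronecker product of \<open>A\<close> and \<open>C\<^sup>T\<close>.\<close>

definition sandwich_matrix ::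
    "('k \<Rightarrow> 'm \<times> 'q) \<Rightarrow> real ^ 'n ^ 'm \<Rightarrow> real ^ 'q ^ 'p \<Rightarrow> real ^ ('n \<times> 'p) ^ 'k"
  where "sandwich_matrix \<sigma> A C = (\<chi> r s. A $ fst (\<sigma> r) $ fst s * C $ snd s $ snd (\<sigma> r))"

lemma sandwich_nth:
  fixes A :: "real ^ 'n ^ 'm" and C :: "real ^ 'q ^ 'p"
  shows "(A ** X ** C) $ i $ l = (\<Sum>s\<in>UNIV. A $ i $ fst s * C $ snd s $ l * X $ fst s $ snd s)"
proof -
  have "(A ** X ** C) $ i $ l = (\<Sum>k\<in>UNIV. \<Sum>j\<in>UNIV. A $ i $ j * C $ k $ l * X $ j $ k)"
    by (simp add: matrix_matrix_mult_def sum_distrib_right sum_distrib_left mult_ac)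
  also have "\<dots> = (\<Sum>j\<in>UNIV. \<Sum>k\<in>UNIV. A $ i $ j * C $ k $ l * X $ j $ k)"
    by (rule sum.swap)
  also have "\<dots> = (\<Sum>s\<in>UNIV. A $ i $ fst s * C $ snd s $ l * X $ fst s $ snd s)"
    by (simp add: sum.cartesian_product UNIV_Times_UNIV case_prod_beta)
  finally show ?thesis .
qed

lemma sandwich_matrix_mult:
  "sandwich_matrix \<sigma> A C *v flatten id X = flatten \<sigma> (A ** X ** C)"
  by (simp add: vec_eq_iff flatten_def sandwich_matrix_def matrix_vector_mult_def sandwich_nth)

lemma transpose_sandwich_matrix_mult:
  assumes "bij \<sigma>"
  shows "transpose (sandwich_matrix \<sigma> A C) *v flatten \<sigma> X
    = flatten id (transpose A ** X ** transpose C)"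
proof -
  have "(\<Sum>r\<in>UNIV. transpose (sandwich_matrix \<sigma> A C) $ s $ r * flatten \<sigma> X $ r)
      = (transpose A ** X ** transpose C) $ fst s $ snd s" for s
  proof -
    let ?h = "\<lambda>t. A $ fst t $ fst s * C $ snd s $ snd t * X $ fst t $ snd t"
    have "(\<Sum>r\<in>UNIV. transpose (sandwich_matrix \<sigma> A C) $ s $ r * flatten \<sigma> X $ r)
        = (\<Sum>r\<in>UNIV. ?h (\<sigma> r))"
      by (simp add: transpose_def sandwich_matrix_def flatten_def)
    also have "\<dots> = (\<Sum>t\<in>UNIV. ?h t)"
      by (rule sum.reindex_bij_betw[OF assms])
    also have "\<dots> = (transpose A ** X ** transpose C) $ fst s $ snd s"
      by (simp add: sandwich_nth transpose_def)
    finally show ?thesis .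
  qed
  then show ?thesis
    by (simp add: vec_eq_iff flatten_def matrix_vector_mult_def del: transpose_matrix_vector)
qed

lemma bij_flatten:
  assumes "bij \<sigma>"
  shows "bij (flatten \<sigma>)"
proof (rule o_bij)
  let ?unflatten = "\<lambda>x. \<chi> i j. x $ inv \<sigma> (i, j)"
  show "?unflatten \<circ> flatten \<sigma> = id"
    using assms by (simp add: fun_eq_iff vec_eq_iff flatten_def bij_is_surj surj_f_inv_f)
  show "flatten \<sigma> \<circ> ?unflatten = id"
    using assms by (simp add: fun_eq_iff vec_eq_iff flatten_def bij_is_inj inv_f_f)
qed

lemma flatten_add: "flatten \<sigma> (X + Y) = flatten \<sigma> X + flatten \<sigma> Y"
  and flatten_abs: "flatten \<sigma> \<bar>X\<bar> = \<bar>flatten \<sigma> X\<bar>"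
  and flatten_0: "flatten \<sigma> 0 = 0"
  by (simp_all add: flatten_def vec_eq_iff abs_vec_def)

lemma flatten_le_iff: "bij \<sigma> \<Longrightarrow> flatten \<sigma> X \<le> flatten \<sigma> Y \<longleftrightarrow> X \<le> Y"
  by (simp add: flatten_def less_eq_vec_def bij_iff) (metis fst_conv snd_conv)

lemma flatten_eq_iff: "bij \<sigma> \<Longrightarrow> flatten \<sigma> X = flatten \<sigma> Y \<longleftrightarrow> X = Y"
  by (simp add: bij_flatten bij_is_inj inj_eq)

lemma flatten_eq_0_iff: "bij \<sigma> \<Longrightarrow> flatten \<sigma> X = 0 \<longleftrightarrow> X = 0"
  using flatten_eq_iff[of \<sigma> X 0] by (simp add: flatten_0)

lemma all_flatten_iff: "bij \<sigma> \<Longrightarrow> (\<forall>x. P x) \<longleftrightarrow> (\<forall>X. P (flatten \<sigma> X))"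
  using bij_is_surj[OF bij_flatten, of \<sigma>] unfolding surj_def by metis

section \<open>Two-sided matrix equations\<close>

theorem theorem12:
  fixes A B :: "real ^ 'n ^ 'm"
    and C E :: "real ^ 'q ^ 'p"
  assumes "CARD('m) * CARD('q) = CARD('n) * CARD('p)"
  shows "((\<forall>F :: real ^ 'q ^ 'm. \<exists>!X :: real ^ 'p ^ 'n. A ** X ** C + B ** \<bar>X\<bar> ** E = F)
          \<longleftrightarrow> (\<forall>X :: real ^ 'q ^ 'm.
                 \<bar>transpose A ** X ** transpose C\<bar> \<le> \<bar>transpose B ** X ** transpose E\<bar>
                 \<longleftrightarrow> X = 0))
       \<and> ((\<forall>X :: real ^ 'q ^ 'm.
                 \<bar>transpose A ** X ** transpose C\<bar> \<le> \<bar>transpose B ** X ** transpose E\<bar>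
                 \<longleftrightarrow> X = 0)
          \<longleftrightarrow> (\<forall>X Y :: real ^ 'p ^ 'n.
                 A ** X ** C + B ** Y ** E = 0 \<and> \<bar>Y\<bar> \<le> \<bar>X\<bar> \<longleftrightarrow> X = 0 \<and> Y = 0))"
    (is "(?unique \<longleftrightarrow> ?inequality) \<and> (_ \<longleftrightarrow> ?dominated)")
proof -
  have "card (UNIV :: ('n \<times> 'p) set) = card (UNIV :: ('m \<times> 'q) set)"
    using assms by simp
  then obtain \<sigma> :: "'n \<times> 'p \<Rightarrow> 'm \<times> 'q" where \<sigma>: "bij \<sigma>"
    by (metis finite finite_same_card_bij)
  define G where "G = sandwich_matrix \<sigma> A C"
  define H where "H = sandwich_matrix \<sigma> B E"
  note flatten_simps = sandwich_matrix_mult transpose_sandwich_matrix_mult[OF \<sigma>]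
    flatten_add[symmetric] flatten_abs[symmetric] flatten_le_iff flatten_eq_iff flatten_eq_0_iff

  have map: "abs_value_map G H (flatten id X) = flatten \<sigma> (A ** X ** C + B ** \<bar>X\<bar> ** E)" for X
    by (simp add: abs_value_map_def G_def H_def flatten_simps)
  have "?unique \<longleftrightarrow> bij (\<lambda>X. A ** X ** C + B ** \<bar>X\<bar> ** E)"
    by (auto simp: bij_iff)
  also have "\<dots> \<longleftrightarrow> bij (flatten \<sigma> \<circ> (\<lambda>X. A ** X ** C + B ** \<bar>X\<bar> ** E))"
    by (rule bij_betw_comp_iff2[OF bij_flatten[OF \<sigma>]]) simp
  also have "flatten \<sigma> \<circ> (\<lambda>X. A ** X ** C + B ** \<bar>X\<bar> ** E) = abs_value_map G H \<circ> flatten id"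
    by (simp add: fun_eq_iff map)
  also have "bij \<dots> \<longleftrightarrow> bij (abs_value_map G H)"
    by (rule bij_betw_comp_iff[OF bij_flatten[OF bij_id], symmetric])
  finally have "?unique \<longleftrightarrow> cube_regular G H"
    by (simp add: bij_abs_value_map_iff_cube_regular)

  moreover have "?inequality \<longleftrightarrow> cube_regular G H"
  proof -
    have "cube_regular G H \<longleftrightarrow> (\<forall>X :: real ^ 'q ^ 'm.
        \<bar>transpose A ** X ** transpose C\<bar> \<le> \<bar>transpose B ** X ** transpose E\<bar> \<longrightarrow> X = 0)"
      unfolding cube_regular_iff_transposed_inequality all_flatten_iff[OF \<sigma>]
      by (simp add: G_def H_def flatten_simps \<sigma> del: transpose_matrix_vector)
    moreover have "\<bar>transpose A ** (0 :: real ^ 'q ^ 'm) ** transpose C\<bar>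
        \<le> \<bar>transpose B ** (0 :: real ^ 'q ^ 'm) ** transpose E\<bar>"
      by (simp add: less_eq_vec_def abs_vec_def)
    ultimately show ?thesis by blast
  qed

  moreover have "?dominated \<longleftrightarrow> cube_regular G H"
  proof -
    have "cube_regular G H \<longleftrightarrow> (\<forall>X Y :: real ^ 'p ^ 'n.
        A ** X ** C + B ** Y ** E = 0 \<and> \<bar>Y\<bar> \<le> \<bar>X\<bar> \<longrightarrow> X = 0)"
      unfolding cube_regular_iff_dominated_system all_flatten_iff[OF bij_id]
      by (simp add: G_def H_def flatten_simps \<sigma>)
    moreover have "Y = 0" if "\<bar>Y\<bar> \<le> \<bar>X\<bar>" "X = 0" for X Y :: "real ^ 'p ^ 'n"
      using that by (simp add: matrix_le_iff_entrywise matrix_abs_nth vec_eq_iff)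
    moreover have "A ** (0 :: real ^ 'p ^ 'n) ** C + B ** (0 :: real ^ 'p ^ 'n) ** E = 0"
      by simp
    ultimately show ?thesis by auto
  qed
  ultimately show ?thesis by blast
qed

end
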